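(* Let $w\in C([0,1];\mathbb R^d)$ with $w_0=0$, let $b:\mathbb R^d\to\mathbb R^d$ be bounded and continuous, let $\gamma>1/2$, let $\psi$ be a weight, and assume that $\|T^wb\|_{\mathscr C^\gamma([0,1];\mathscr C^{3/2,\psi})}<+\infty$. Then for any $x_0\in\mathbb R^d$ there exists a unique continuous solution $x\in C([0,1];\mathbb R^d)$ of $$x_t=x_0+\int_0^tb(x_s)\,ds+w_t,\qquad t\in[0,1],$$ and the flow map $x_0\mapsto x_t$ of the equation is locally Lipschitz continuous in space, uniformly in $t\in[0,1]$.
   Context: Averaging operator: $T^w_tb(x)=\int_0^tb(x+w_r)\,dr$. A weight is a continuous non-decreasing function $\psi:\mathbb R_+\to\mathbb R_+$ such that for each $c>0$ there is a constant $C_{c,\psi}>0$ with $\psi(cx)\le C_{c,\psi}\psi(x)$ for all $x\geq 0$. $\mathscr C^{3/2,\psi}$ is the space of continuously differentiable $g:\mathbb R^d\to\mathbb R^d$ with $$\|g\|_{\mathscr C^{3/2,\psi}}=\sup_{x\ne y}\frac{|Dg(x)-Dg(y)|}{|x-y|^{1/2}\psi(|x|+|y|)}+|g(0)|+|Dg(0)|<\infty,$$ and $\|T^wb\|_{\mathscr C^\gamma([0,1];\mathscr C^{3/2,\psi})}=\sup_{0\le s<t\le1}\|T^w_tb-T^w_sb\|_{\mathscr C^{3/2,\psi}}/|t-s|^\gamma$. *)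

theory Defs
  imports "HOL-Analysis.Analysis"
begin

definition averaging ::
  "(real \<Rightarrow> real ^ 'n) \<Rightarrow> (real ^ 'n \<Rightarrow> real ^ 'n) \<Rightarrow> real \<Rightarrow> real ^ 'n \<Rightarrow> real ^ 'n" where
  "averaging w b t x = integral {0..t} (\<lambda>r. b (x + w r))"

(* Only the values of psi on [0,\<infinity>) are relevant. *)
definition weight :: "(real \<Rightarrow> real) \<Rightarrow> bool" where
  "weight \<psi> \<longleftrightarrow>
     continuous_on {0..} \<psi> \<and> mono_on {0..} \<psi> \<and> (\<forall>x\<ge>0. \<psi> x \<ge> 0) \<and>
     (\<forall>c>0. \<exists>C>0. \<forall>x\<ge>0. \<psi> (c * x) \<le> C * \<psi> x)"

definition total_deriv ::
  "(real ^ 'n \<Rightarrow> real ^ 'n) \<Rightarrow> real ^ 'n \<Rightarrow> ((real ^ 'n) \<Rightarrow>\<^sub>L (real ^ 'n))" where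
  "total_deriv g x = Blinfun (frechet_derivative g (at x))"

definition cont_diff :: "(real ^ 'n \<Rightarrow> real ^ 'n) \<Rightarrow> bool" where
  "cont_diff g \<longleftrightarrow> (\<forall>x. g differentiable at x) \<and> continuous_on UNIV (total_deriv g)"

(* The norm takes values in [0,\<infinity>] and is \<infinity> off the continuously differentiable functions, so that
   the space C^{3/2,psi} consists of the g of finite norm. |Dg| is the operator norm. In ennreal,
   a / 0 = \<infinity> for a > 0 and 0 / 0 = 0: a vanishing psi forces Dg to be constant (division in the
   reals would instead make the seminorm zero). *)
definition C32_norm :: "(real \<Rightarrow> real) \<Rightarrow> (real ^ 'n \<Rightarrow> real ^ 'n) \<Rightarrow> ennreal" where
  "C32_norm \<psi> g =
     (if cont_diff g then
        (SUP (x, y) \<in> {(x, y). x \<noteq> y}.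
           ennreal (norm (total_deriv g x - total_deriv g y)) /
           ennreal (norm (x - y) powr (1/2) * \<psi> (norm x + norm y)))
        + ennreal (norm (g 0)) + ennreal (norm (total_deriv g 0))
      else \<infinity>)"

definition time_Holder_C32_norm ::
  "real \<Rightarrow> (real \<Rightarrow> real) \<Rightarrow> (real \<Rightarrow> real ^ 'n \<Rightarrow> real ^ 'n) \<Rightarrow> ennreal" where
  "time_Holder_C32_norm \<gamma> \<psi> T =
     (SUP (s, t) \<in> {(s, t). 0 \<le> s \<and> s < t \<and> t \<le> 1}.
        C32_norm \<psi> (\<lambda>x. T t x - T s x) / ennreal (\<bar>t - s\<bar> powr \<gamma>))"

definition solves ::
  "(real \<Rightarrow> real ^ 'n) \<Rightarrow> (real ^ 'n \<Rightarrow> real ^ 'n) \<Rightarrow> real ^ 'n \<Rightarrow> (real \<Rightarrow> real ^ 'n) \<Rightarrow> bool" where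
  "solves w b x0 x \<longleftrightarrow>
     continuous_on {0..1} x \<and>
     (\<forall>t\<in>{0..1}. x t = x0 + integral {0..t} (\<lambda>s. b (x s)) + w t)"

end

theory Submission
  imports Defs "HOL-Complex_Analysis.Great_Picard"
begin

text \<open>
  Subtracting \<open>w\<close> turns the equation into \<open>\<theta>\<^sub>t = x\<^sub>0 + \<integral>\<^sub>0\<^sup>t b (\<theta>\<^sub>r + w\<^sub>r) dr\<close>, whose solutions exist
  by Peano's theorem and are Lipschitz in time. Let \<open>e\<close> be the difference of two solutions \<open>\<theta>\<close>, \<open>\<eta>\<close>
  and \<open>G\<^bsub>s,t\<^esub> = T\<^sub>t b - T\<^sub>s b\<close>. The germ \<open>A\<^bsub>s,t\<^esub> = G\<^bsub>s,t\<^esub> \<theta>\<^sub>s - G\<^bsub>s,t\<^esub> \<eta>\<^sub>s\<close> approximates \<open>e\<^sub>t - e\<^sub>s\<close> up to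
  \<open>o(t - s)\<close>. If \<open>G\<^bsub>s,t\<^esub>\<close> is of class \<open>C\<^bsup>1+\<alpha>\<^esup>\<close> with norm of order \<open>(t - s)\<^sup>\<gamma>\<close>, the defect of additivity of \<open>A\<close>
  is of order \<open>(t - s)\<^bsup>\<alpha>+\<gamma>\<^esup>\<close> times the sum of the sup norm and the \<open>\<alpha>\<close>-Hoelder constant of \<open>e\<close>. As
  \<open>\<alpha> + \<gamma> > 1\<close>, repeated halving of \<open>[s,t]\<close> bounds \<open>e\<^sub>t - e\<^sub>s - A\<^bsub>s,t\<^esub>\<close> by the same quantity. As \<open>\<alpha> < \<gamma>\<close>,
  this estimate absorbs the Hoelder constant of \<open>e\<close> on short intervals, so \<open>\<bar>e\<bar>\<close> at most doubles there,
  and finitely many such intervals cover \<open>[0,1]\<close>. The theorem is the case \<open>\<alpha> = 1/2\<close>.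
\<close>

section \<open>Hoelder continuity\<close>

definition holder_on :: "real \<Rightarrow> real \<Rightarrow> 'a::metric_space set \<Rightarrow> ('a \<Rightarrow> 'b::metric_space) \<Rightarrow> bool" where
  "holder_on \<alpha> C X f \<longleftrightarrow> 0 \<le> C \<and> (\<forall>x\<in>X. \<forall>y\<in>X. dist (f x) (f y) \<le> C * dist x y powr \<alpha>)"

lemma holder_onD:
  "holder_on \<alpha> C X f \<Longrightarrow> x \<in> X \<Longrightarrow> y \<in> X \<Longrightarrow> dist (f x) (f y) \<le> C * dist x y powr \<alpha>"
  by (simp add: holder_on_def)

lemma holder_on_nonneg: "holder_on \<alpha> C X f \<Longrightarrow> 0 \<le> C"
  by (simp add: holder_on_def)

lemma holder_on_subset: "holder_on \<alpha> C X f \<Longrightarrow> Y \<subseteq> X \<Longrightarrow> holder_on \<alpha> C Y f"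
  by (auto simp: holder_on_def)

lemma holder_on_mono:
  assumes "holder_on \<alpha> C X f" "C \<le> C'"
  shows "holder_on \<alpha> C' X f"
proof -
  have "C * dist x y powr \<alpha> \<le> C' * dist x y powr \<alpha>" for x y :: 'a
    using \<open>C \<le> C'\<close> by (intro mult_right_mono) auto
  then show ?thesis using assms unfolding holder_on_def by (meson order_trans)
qed

lemma holder_on_lessI:
  fixes f :: "real \<Rightarrow> 'a::metric_space"
  assumes "0 \<le> C"
    and "\<And>s t. s \<in> X \<Longrightarrow> t \<in> X \<Longrightarrow> s < t \<Longrightarrow> dist (f s) (f t) \<le> C * (t - s) powr \<alpha>"
  shows "holder_on \<alpha> C X f"
proof -
  have "dist (f s) (f t) \<le> C * dist s t powr \<alpha>" if "s \<in> X" "t \<in> X" for s t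
    using assms(2)[of s t] assms(2)[of t s] that
    by (cases s t rule: linorder_cases) (auto simp: dist_commute dist_real_def)
  with \<open>0 \<le> C\<close> show ?thesis by (simp add: holder_on_def)
qed

lemma lipschitz_on_imp_holder_on:
  assumes f: "C-lipschitz_on X f" and diam: "\<And>x y. x \<in> X \<Longrightarrow> y \<in> X \<Longrightarrow> dist x y \<le> 1"
    and "\<alpha> \<le> 1"
  shows "holder_on \<alpha> C X f"
proof -
  have C_nonneg: "0 \<le> C" using f by (rule lipschitz_on_nonneg)
  have "dist (f x) (f y) \<le> C * dist x y powr \<alpha>" if "x \<in> X" "y \<in> X" for x y
  proof -
    have "dist (f x) (f y) \<le> C * dist x y" using f that by (rule lipschitz_onD)
    also have "dist x y \<le> dist x y powr \<alpha>"
      using powr_mono'[of \<alpha> 1 "dist x y"] \<open>\<alpha> \<le> 1\<close> diam[OF that] by simp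
    finally show ?thesis using C_nonneg by (simp add: mult_left_mono)
  qed
  with C_nonneg show ?thesis by (simp add: holder_on_def)
qed

text \<open>The fixed point of \<open>C \<mapsto> k * (q + C)\<close> is reached by iteration from the finite constant \<open>C\<^sub>0\<close>.\<close>
lemma holder_on_self_improvement:
  assumes f: "holder_on \<alpha> C\<^sub>0 X f" and k: "0 \<le> k" "k < 1"
    and improve: "\<And>C. holder_on \<alpha> C X f \<Longrightarrow> holder_on \<alpha> (k * (q + C)) X f"
  shows "holder_on \<alpha> (k * q / (1 - k)) X f"
proof -
  define P where "P = k * q / (1 - k)"
  have fixed_point: "k * (q + P) = P" using k by (simp add: P_def field_simps)
  have iterate: "holder_on \<alpha> (P + k ^ n * (C\<^sub>0 - P)) X f" for n
  proof (induction n)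
    case 0
    show ?case using f by simp
  next
    case (Suc n)
    have "k * (q + (P + k ^ n * (C\<^sub>0 - P))) = k * (q + P) + k ^ Suc n * (C\<^sub>0 - P)"
      by (simp add: algebra_simps)
    then show ?case using improve[OF Suc.IH] by (simp add: fixed_point)
  qed
  have "(\<lambda>n. P + k ^ n * (C\<^sub>0 - P)) \<longlonglongrightarrow> P + 0 * (C\<^sub>0 - P)"
    using k by (intro tendsto_intros LIMSEQ_power_zero) simp
  then have lim: "(\<lambda>n. P + k ^ n * (C\<^sub>0 - P)) \<longlonglongrightarrow> P" by simp
  have "0 \<le> P"
    using lim by (rule LIMSEQ_le_const) (use iterate holder_on_nonneg in blast)
  moreover have "dist (f x) (f y) \<le> P * dist x y powr \<alpha>" if "x \<in> X" "y \<in> X" for x y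
    using tendsto_mult_right[OF lim]
    by (rule LIMSEQ_le_const) (use holder_onD[OF iterate that] in blast)
  ultimately show ?thesis by (simp add: holder_on_def P_def)
qed

definition C1_holder_on ::
  "real \<Rightarrow> real \<Rightarrow> 'a::real_normed_vector set \<Rightarrow> ('a \<Rightarrow> 'b::real_normed_vector) \<Rightarrow> bool" where
  "C1_holder_on \<alpha> L X g \<longleftrightarrow>
     (\<exists>D. (\<forall>x\<in>X. (g has_derivative blinfun_apply (D x)) (at x within X) \<and> norm (D x) \<le> L) \<and>
          holder_on \<alpha> L X D)"

lemma C1_holder_on_subset:
  assumes "C1_holder_on \<alpha> L X g" "Y \<subseteq> X"
  shows "C1_holder_on \<alpha> L Y g"
proof -
  obtain D where "\<forall>x\<in>X. (g has_derivative blinfun_apply (D x)) (at x within X) \<and> norm (D x) \<le> L"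
    and "holder_on \<alpha> L X D"
    using assms(1) unfolding C1_holder_on_def by blast
  with \<open>Y \<subseteq> X\<close> show ?thesis
    unfolding C1_holder_on_def
    by (intro exI[of _ D]) (auto intro: has_derivative_subset holder_on_subset)
qed

lemma C1_holder_on_imp_lipschitz_on:
  assumes "C1_holder_on \<alpha> L X g" "convex X"
  shows "L-lipschitz_on X g"
proof -
  obtain D where D: "\<And>x. x \<in> X \<Longrightarrow> (g has_derivative blinfun_apply (D x)) (at x within X)"
    "\<And>x. x \<in> X \<Longrightarrow> norm (D x) \<le> L" and "0 \<le> L"
    using assms(1) holder_on_nonneg unfolding C1_holder_on_def by blast
  have "norm (g x - g y) \<le> L * norm (x - y)" if "x \<in> X" "y \<in> X" for x y
    using assms(2) D that
    by (intro differentiable_bound[of X g "\<lambda>x. blinfun_apply (D x)"])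
      (auto simp flip: norm_blinfun.rep_eq)
  with \<open>0 \<le> L\<close> show ?thesis by (intro lipschitz_onI) (simp_all add: dist_norm)
qed

lemma norm_blinfun_apply_diff_le:
  "norm (blinfun_apply P v - blinfun_apply Q u) \<le> norm P * norm (v - u) + norm (P - Q) * norm u"
proof -
  have "blinfun_apply P v - blinfun_apply Q u = blinfun_apply P (v - u) + blinfun_apply (P - Q) u"
    by (simp add: blinfun.bilinear_simps)
  then show ?thesis by (simp add: norm_triangle_le add_mono norm_blinfun)
qed

lemma norm_segment_diff_le:
  fixes a b c d :: "'a::real_normed_vector"
  assumes "norm (a - c) \<le> m" "norm (b - d) \<le> m" "l \<in> {0..1}"
  shows "norm ((b + l *\<^sub>R (a - b)) - (d + l *\<^sub>R (c - d))) \<le> m"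
proof -
  have "(1 - l) *\<^sub>R (b - d) + l *\<^sub>R (a - c) \<in> cball 0 m"
    using assms by (intro convexD[OF convex_cball]) auto
  then show ?thesis by (simp add: algebra_simps)
qed

lemma segment_in_convex:
  assumes "convex X" "a \<in> X" "b \<in> X" "l \<in> {0..1}"
  shows "b + l *\<^sub>R (a - b) \<in> X"
  using convexD[OF assms(1,3,2), of "1 - l" l] assms(4) by (simp add: algebra_simps)

lemma has_vector_derivative_along_segment:
  assumes "\<And>x. x \<in> X \<Longrightarrow> (g has_derivative blinfun_apply (D x)) (at x within X)"
    and "convex X" "a \<in> X" "b \<in> X" "l \<in> {0..1}"
  shows "((\<lambda>l. g (b + l *\<^sub>R (a - b))) has_vector_derivative
    blinfun_apply (D (b + l *\<^sub>R (a - b))) (a - b)) (at l within {0..1})"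
proof -
  have "((\<lambda>l. b + l *\<^sub>R (a - b)) has_vector_derivative (a - b)) (at l within {0..1})"
    by (auto intro!: derivative_eq_intros)
  moreover have "(g has_derivative blinfun_apply (D (b + l *\<^sub>R (a - b))))
      (at (b + l *\<^sub>R (a - b)) within (\<lambda>l. b + l *\<^sub>R (a - b)) ` {0..1})"
    using assms by (intro has_derivative_subset[OF assms(1)]) (auto intro: segment_in_convex)
  ultimately show ?thesis
    using vector_derivative_diff_chain_within by (fastforce simp: o_def)
qed

text \<open>Mean value inequality for \<open>l \<mapsto> g (b + l (a - b)) - g (d + l (c - d))\<close>.\<close>
lemma C1_holder_on_second_difference:
  fixes g :: "'a::real_normed_vector \<Rightarrow> 'b::real_normed_vector"
  assumes g: "C1_holder_on \<alpha> L X g" and "0 \<le> \<alpha>" "convex X"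
    and X: "a \<in> X" "b \<in> X" "c \<in> X" "d \<in> X"
    and m: "norm (a - c) \<le> m" "norm (b - d) \<le> m"
  shows "norm ((g a - g b) - (g c - g d)) \<le>
    L * (norm ((a - b) - (c - d)) + m powr \<alpha> * norm (c - d))"
proof -
  obtain D where D: "\<And>x. x \<in> X \<Longrightarrow> (g has_derivative blinfun_apply (D x)) (at x within X)"
    "\<And>x. x \<in> X \<Longrightarrow> norm (D x) \<le> L" and holder: "holder_on \<alpha> L X D"
    using g unfolding C1_holder_on_def by blast
  define p where "p l = b + l *\<^sub>R (a - b)" for l
  define q where "q l = d + l *\<^sub>R (c - d)" for l
  define \<phi>' where "\<phi>' l = blinfun_apply (D (p l)) (a - b) - blinfun_apply (D (q l)) (c - d)" for l
  define B where "B = L * (norm ((a - b) - (c - d)) + m powr \<alpha> * norm (c - d))"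
  have deriv: "((\<lambda>l. g (p l) - g (q l)) has_vector_derivative \<phi>' l) (at l within {0..1})"
    if "l \<in> {0..1}" for l
    unfolding p_def q_def \<phi>'_def using that \<open>convex X\<close> X D(1)
    by (intro has_vector_derivative_diff has_vector_derivative_along_segment) auto
  have bound: "norm (\<phi>' l) \<le> B" if l: "l \<in> {0..1}" for l
  proof -
    have pq: "p l \<in> X" "q l \<in> X"
      unfolding p_def q_def using \<open>convex X\<close> X l by (auto intro: segment_in_convex)
    have "norm (D (p l) - D (q l)) \<le> L * norm (p l - q l) powr \<alpha>"
      using holder_onD[OF holder pq] by (simp add: dist_norm)
    also have "\<dots> \<le> L * m powr \<alpha>"
      unfolding p_def q_def using holder_on_nonneg[OF holder] norm_segment_diff_le[OF m l] \<open>0 \<le> \<alpha>\<close>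
      by (intro mult_left_mono powr_mono2) auto
    finally have "norm (D (p l) - D (q l)) \<le> L * m powr \<alpha>" .
    then have "norm (D (p l)) * norm ((a - b) - (c - d)) + norm (D (p l) - D (q l)) * norm (c - d) \<le>
        L * norm ((a - b) - (c - d)) + L * m powr \<alpha> * norm (c - d)"
      using D(2) pq by (intro add_mono mult_right_mono) auto
    also have "\<dots> = B" by (simp add: B_def algebra_simps)
    finally show ?thesis
      unfolding \<phi>'_def using norm_blinfun_apply_diff_le order_trans by blast
  qed
  have "norm ((g (p 1) - g (q 1)) - (g (p 0) - g (q 0))) \<le> B * norm (1 - 0 :: real)"
    using deriv bound unfolding has_vector_derivative_def
    by (intro differentiable_bound[where S = "{0..1}" and f' = "\<lambda>l h. h *\<^sub>R \<phi>' l"] onorm_le)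
      (auto simp: mult.commute[of B] intro: mult_left_mono)
  then show ?thesis by (simp add: p_def q_def B_def algebra_simps)
qed

section \<open>The sewing estimate\<close>

definition negligible_germ_on :: "real set \<Rightarrow> (real \<Rightarrow> real \<Rightarrow> 'a::real_normed_vector) \<Rightarrow> bool" where
  "negligible_germ_on X R \<longleftrightarrow>
     (\<forall>\<epsilon>>0. \<exists>\<delta>>0. \<forall>s\<in>X. \<forall>t\<in>X. s < t \<longrightarrow> t - s \<le> \<delta> \<longrightarrow> norm (R s t) \<le> \<epsilon> * (t - s))"

lemma negligible_germ_onD:
  assumes "negligible_germ_on X R" "0 < \<epsilon>"
  obtains \<delta> where "0 < \<delta>"
    and "\<And>s t. s \<in> X \<Longrightarrow> t \<in> X \<Longrightarrow> s < t \<Longrightarrow> t - s \<le> \<delta> \<Longrightarrow> norm (R s t) \<le> \<epsilon> * (t - s)"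
  using assms(1)[unfolded negligible_germ_on_def, rule_format, OF assms(2)] by auto

lemma negligible_germ_on_subset:
  assumes "negligible_germ_on X R" "Y \<subseteq> X"
  shows "negligible_germ_on Y R"
  unfolding negligible_germ_on_def
proof (intro allI impI)
  fix \<epsilon> :: real assume "0 < \<epsilon>"
  then obtain \<delta> where "0 < \<delta>"
    and "\<And>s t. s \<in> X \<Longrightarrow> t \<in> X \<Longrightarrow> s < t \<Longrightarrow> t - s \<le> \<delta> \<Longrightarrow> norm (R s t) \<le> \<epsilon> * (t - s)"
    using assms(1) negligible_germ_onD by blast
  with \<open>Y \<subseteq> X\<close> show "\<exists>\<delta>>0. \<forall>s\<in>Y. \<forall>t\<in>Y. s < t \<longrightarrow> t - s \<le> \<delta> \<longrightarrow> norm (R s t) \<le> \<epsilon> * (t - s)"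
    by (intro exI[of _ \<delta>]) auto
qed

lemma negligible_germ_on_diff:
  assumes "negligible_germ_on X R" "negligible_germ_on X S"
  shows "negligible_germ_on X (\<lambda>s t. R s t - S s t)"
  unfolding negligible_germ_on_def
proof (intro allI impI)
  fix \<epsilon> :: real assume "0 < \<epsilon>"
  then have "0 < \<epsilon> / 2" by simp
  obtain \<delta>\<^sub>R where R_small: "0 < \<delta>\<^sub>R"
    "\<And>s t. s \<in> X \<Longrightarrow> t \<in> X \<Longrightarrow> s < t \<Longrightarrow> t - s \<le> \<delta>\<^sub>R \<Longrightarrow> norm (R s t) \<le> \<epsilon> / 2 * (t - s)"
    using that by (rule negligible_germ_onD[OF assms(1) \<open>0 < \<epsilon> / 2\<close>])
  obtain \<delta>\<^sub>S where S_small: "0 < \<delta>\<^sub>S"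
    "\<And>s t. s \<in> X \<Longrightarrow> t \<in> X \<Longrightarrow> s < t \<Longrightarrow> t - s \<le> \<delta>\<^sub>S \<Longrightarrow> norm (S s t) \<le> \<epsilon> / 2 * (t - s)"
    using that by (rule negligible_germ_onD[OF assms(2) \<open>0 < \<epsilon> / 2\<close>])
  have "norm (R s t - S s t) \<le> \<epsilon> * (t - s)"
    if "s \<in> X" "t \<in> X" "s < t" "t - s \<le> min \<delta>\<^sub>R \<delta>\<^sub>S" for s t
  proof -
    have "norm (R s t - S s t) \<le> norm (R s t) + norm (S s t)" by (rule norm_triangle_ineq4)
    also have "\<dots> \<le> \<epsilon> / 2 * (t - s) + \<epsilon> / 2 * (t - s)"
      using that by (intro add_mono R_small S_small) auto
    finally show ?thesis by simp
  qed
  then show "\<exists>\<delta>>0. \<forall>s\<in>X. \<forall>t\<in>X. s < t \<longrightarrow> t - s \<le> \<delta> \<longrightarrow> norm (R s t - S s t) \<le> \<epsilon> * (t - s)"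
    using R_small(1) S_small(1) by (intro exI[of _ "min \<delta>\<^sub>R \<delta>\<^sub>S"]) auto
qed

definition sewing_constant :: "real \<Rightarrow> real" where
  "sewing_constant p = 1 / (1 - 2 powr (1 - p))"

lemma sewing_constant_nonneg: "1 < p \<Longrightarrow> 0 \<le> sewing_constant p"
  by (simp add: sewing_constant_def powr_less_one less_imp_le)

lemma sewing_constant_halving:
  assumes "1 < p" "0 < h"
  shows "2 * (sewing_constant p * (h / 2) powr p) + h powr p = sewing_constant p * h powr p"
proof -
  have "1 - 2 powr (1 - p) \<noteq> 0" using \<open>1 < p\<close> by simp
  then have "sewing_constant p * (1 - 2 powr (1 - p)) = 1" unfolding sewing_constant_def by simp
  then have "sewing_constant p * 2 powr (1 - p) + 1 = sewing_constant p"
    by (simp add: algebra_simps)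
  moreover have "2 * (sewing_constant p * (h / 2) powr p) =
      sewing_constant p * 2 powr (1 - p) * h powr p"
    using \<open>0 < h\<close> by (simp add: powr_divide powr_diff)
  ultimately show ?thesis by (metis distrib_right mult_1)
qed

lemma midpoint_subadditive_bound:
  fixes r :: "real \<Rightarrow> real \<Rightarrow> real"
  assumes "1 < p" "0 \<le> N" "0 < \<delta>"
    and midpoint: "\<And>s t. a \<le> s \<Longrightarrow> s < t \<Longrightarrow> t \<le> c \<Longrightarrow>
      r s t \<le> r s ((s + t) / 2) + r ((s + t) / 2) t + N * (t - s) powr p"
    and short: "\<And>s t. a \<le> s \<Longrightarrow> s < t \<Longrightarrow> t \<le> c \<Longrightarrow> t - s \<le> \<delta> \<Longrightarrow> r s t \<le> \<epsilon> * (t - s)"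
    and st: "a \<le> s" "s < t" "t \<le> c"
  shows "r s t \<le> N * sewing_constant p * (t - s) powr p + \<epsilon> * (t - s)"
proof -
  define C where "C = N * sewing_constant p"
  have C_nonneg: "0 \<le> C" using assms(1,2) by (simp add: C_def sewing_constant_nonneg)
  have dyadic: "r s t \<le> C * (t - s) powr p + \<epsilon> * (t - s)"
    if "a \<le> s" "s < t" "t \<le> c" "t - s \<le> 2 ^ n * \<delta>" for n s t
    using that
  proof (induction n arbitrary: s t)
    case 0
    then have "r s t \<le> \<epsilon> * (t - s)" by (intro short) auto
    then show ?case using C_nonneg by (simp add: add_increasing)
  next
    case (Suc n)
    define u h where "u = (s + t) / 2" and "h = t - s"
    have midpoint_u: "s < u" "u < t" "u - s = h / 2" "t - u = h / 2"
      using Suc.prems by (auto simp: u_def h_def field_simps)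
    have half_short: "0 < h" "h / 2 \<le> 2 ^ n * \<delta>" using Suc.prems by (auto simp: h_def)
    have "r s u \<le> C * (h / 2) powr p + \<epsilon> * (h / 2)"
      using Suc.IH[of s u] Suc.prems midpoint_u half_short by simp
    moreover have "r u t \<le> C * (h / 2) powr p + \<epsilon> * (h / 2)"
      using Suc.IH[of u t] Suc.prems midpoint_u half_short by simp
    moreover have "r s t \<le> r s u + r u t + N * h powr p"
      using midpoint Suc.prems by (simp add: u_def h_def)
    ultimately have "r s t \<le> 2 * (C * (h / 2) powr p) + N * h powr p + \<epsilon> * h" by argo
    also have "\<dots> = N * (2 * (sewing_constant p * (h / 2) powr p) + h powr p) + \<epsilon> * h"
      by (simp add: C_def algebra_simps)
    also have "\<dots> = C * h powr p + \<epsilon> * h"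
      using sewing_constant_halving[OF assms(1) half_short(1)] by (simp add: C_def)
    finally show ?case by (simp add: h_def)
  qed
  obtain n where "(t - s) / \<delta> < 2 ^ n" using real_arch_pow[of 2 "(t - s) / \<delta>"] by auto
  then show ?thesis using dyadic[OF st, of n] \<open>0 < \<delta>\<close> by (simp add: C_def field_simps)
qed

theorem sewing_bound:
  fixes A :: "real \<Rightarrow> real \<Rightarrow> 'a::real_normed_vector" and e :: "real \<Rightarrow> 'a"
  assumes p: "1 < p" and N: "0 \<le> N"
    and defect: "\<And>s u t. a \<le> s \<Longrightarrow> s < u \<Longrightarrow> u < t \<Longrightarrow> t \<le> c \<Longrightarrow>
      norm (A s t - A s u - A u t) \<le> N * (t - s) powr p"
    and germ: "negligible_germ_on {a..c} (\<lambda>s t. e t - e s - A s t)"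
    and st: "a \<le> s" "s < t" "t \<le> c"
  shows "norm (e t - e s - A s t) \<le> N * sewing_constant p * (t - s) powr p"
proof (rule field_le_epsilon)
  define R where "R s t = e t - e s - A s t" for s t
  have subadd: "norm (R s t) \<le> norm (R s u) + norm (R u t) + N * (t - s) powr p"
    if "a \<le> s" "s < u" "u < t" "t \<le> c" for s u t
  proof -
    have "R s t = R s u + R u t - (A s t - A s u - A u t)" by (simp add: R_def)
    also have "norm \<dots> \<le> norm (R s u) + norm (R u t) + norm (A s t - A s u - A u t)"
      by (meson add_mono norm_triangle_ineq norm_triangle_ineq4 order_refl order_trans)
    finally show ?thesis using defect[OF that] by simp
  qed
  fix \<eta> :: real assume "0 < \<eta>"
  then have "0 < \<eta> / (t - s)" using st by simp
  obtain \<delta> where "0 < \<delta>" and short: "\<And>s' t'. s' \<in> {a..c} \<Longrightarrow> t' \<in> {a..c} \<Longrightarrow> s' < t' \<Longrightarrow> t' - s' \<le> \<delta> \<Longrightarrow>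
      norm (R s' t') \<le> \<eta> / (t - s) * (t' - s')"
    using that by (rule negligible_germ_onD[OF germ[folded R_def] \<open>0 < \<eta> / (t - s)\<close>])
  have "norm (R s t) \<le> N * sewing_constant p * (t - s) powr p + \<eta> / (t - s) * (t - s)"
  proof (rule midpoint_subadditive_bound[OF p N \<open>0 < \<delta>\<close> _ _ st])
    show "norm (R s' t') \<le>
        norm (R s' ((s' + t') / 2)) + norm (R ((s' + t') / 2) t') + N * (t' - s') powr p"
      if "a \<le> s'" "s' < t'" "t' \<le> c" for s' t'
      using that by (intro subadd) auto
  qed (use short in auto)
  then show "norm (e t - e s - A s t) \<le> N * sewing_constant p * (t - s) powr p + \<eta>"
    using st by (simp add: R_def)
qed

section \<open>Integral curves of bounded continuous fields\<close>

lemma lipschitz_on_interval_in_cball: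
  fixes f :: "real \<Rightarrow> 'a::metric_space"
  assumes f: "M-lipschitz_on {a..b} f" and t: "t \<in> {a..b}"
  shows "f t \<in> cball (f a) (M * (b - a))"
proof -
  have "dist (f a) (f t) \<le> M * dist a t" using t by (intro lipschitz_onD[OF f]) auto
  also have "\<dots> \<le> M * (b - a)"
    using t lipschitz_on_nonneg[OF f] by (intro mult_left_mono) (auto simp: dist_real_def)
  finally show ?thesis by simp
qed

lemma integral_increment:
  fixes g :: "real \<Rightarrow> 'a::banach"
  assumes "g integrable_on {a..t}" "a \<le> s" "s \<le> t"
  shows "integral {a..t} g - integral {a..s} g = integral {s..t} g"
  using Henstock_Kurzweil_Integration.integral_combine[of a s t g] assms
  by (simp add: algebra_simps)

lemma lipschitz_on_integral:
  fixes g :: "real \<Rightarrow> 'a::banach"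
  assumes g: "continuous_on {a..b} g" and bound: "\<And>r. r \<in> {a..b} \<Longrightarrow> norm (g r) \<le> M" and "0 \<le> M"
  shows "M-lipschitz_on {a..b} (\<lambda>t. integral {a..t} g)"
proof (rule lipschitz_on_leI)
  fix s t assume st: "s \<in> {a..b}" "t \<in> {a..b}" "s \<le> t"
  have "integral {a..t} g - integral {a..s} g = integral {s..t} g"
    using st g
    by (intro integral_increment integrable_continuous_interval continuous_on_subset[OF g]) auto
  then have "dist (integral {a..s} g) (integral {a..t} g) = norm (integral {s..t} g)"
    by (metis dist_commute dist_norm)
  also have "\<dots> \<le> M * (t - s)"
    using st bound by (intro integral_bound continuous_on_subset[OF g]) auto
  finally show "dist (integral {a..s} g) (integral {a..t} g) \<le> M * dist s t"
    using st by (simp add: dist_real_def)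
qed (fact \<open>0 \<le> M\<close>)

lemma lipschitz_sequence_uniform_limit:
  fixes \<Theta> :: "nat \<Rightarrow> 'a::euclidean_space \<Rightarrow> 'b::{real_normed_vector, heine_borel}"
  assumes "compact S" and lip: "\<And>n. M-lipschitz_on S (\<Theta> n)"
    and bound: "\<And>n x. x \<in> S \<Longrightarrow> norm (\<Theta> n x) \<le> B"
  obtains \<theta> k where "continuous_on S \<theta>" "strict_mono (k :: nat \<Rightarrow> nat)"
    "uniform_limit S (\<lambda>n. \<Theta> (k n)) \<theta> sequentially"
proof (rule Arzela_Ascoli[OF \<open>compact S\<close> bound])
  fix x and e :: real assume x: "x \<in> S" and "0 < e"
  have M_nonneg: "0 \<le> M" using lip by (rule lipschitz_on_nonneg)
  have "norm (\<Theta> n x - \<Theta> n y) < e" if "y \<in> S" "norm (x - y) < e / (M + 1)" for n y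
  proof -
    have "norm (\<Theta> n x - \<Theta> n y) \<le> M * norm (x - y)"
      using lipschitz_onD[OF lip x \<open>y \<in> S\<close>] by (simp add: dist_norm)
    also have "\<dots> \<le> (M + 1) * norm (x - y)" by (intro mult_right_mono) auto
    also have "\<dots> < e" using that(2) M_nonneg by (simp add: field_simps)
    finally show ?thesis .
  qed
  then show "\<exists>d. 0 < d \<and> (\<forall>n y. y \<in> S \<and> norm (x - y) < d \<longrightarrow> norm (\<Theta> n x - \<Theta> n y) < e)"
    using \<open>0 < e\<close> M_nonneg by (intro exI[of _ "e / (M + 1)"]) auto
next
  fix \<theta> k assume "continuous_on S \<theta>" "strict_mono (k :: nat \<Rightarrow> nat)"
    "\<And>e. 0 < e \<Longrightarrow> \<exists>N. \<forall>n x. n \<ge> N \<and> x \<in> S \<longrightarrow> norm (\<Theta> (k n) x - \<theta> x) < e"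
  moreover from this(3) have "uniform_limit S (\<lambda>n. \<Theta> (k n)) \<theta> sequentially"
    unfolding uniform_limit_sequentially_iff dist_norm by meson
  ultimately show thesis by (intro that)
qed

lemma le_nat_ceiling_divide_mult:
  fixes x \<tau> :: real
  assumes "0 < \<tau>"
  shows "x \<le> real (nat \<lceil>x / \<tau>\<rceil>) * \<tau>"
  using real_nat_ceiling_ge[of "x / \<tau>"] assms by (simp add: pos_divide_le_eq)

definition integral_curve ::
  "(real \<Rightarrow> 'a::banach \<Rightarrow> 'a) \<Rightarrow> real \<Rightarrow> 'a \<Rightarrow> (real \<Rightarrow> 'a) \<Rightarrow> bool" where
  "integral_curve f T x\<^sub>0 \<theta> \<longleftrightarrow>
     continuous_on {0..T} \<theta> \<and> (\<forall>t\<in>{0..T}. \<theta> t = x\<^sub>0 + integral {0..t} (\<lambda>r. f r (\<theta> r)))"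

lemma integral_curve_continuous_on:
  "integral_curve f T x\<^sub>0 \<theta> \<Longrightarrow> S \<subseteq> {0..T} \<Longrightarrow> continuous_on S \<theta>"
  unfolding integral_curve_def using continuous_on_subset by blast

lemma integral_curve_initial: "integral_curve f T x\<^sub>0 \<theta> \<Longrightarrow> 0 \<le> T \<Longrightarrow> \<theta> 0 = x\<^sub>0"
  by (simp add: integral_curve_def)

definition averaged :: "(real \<Rightarrow> 'a \<Rightarrow> 'a) \<Rightarrow> real \<Rightarrow> real \<Rightarrow> 'a \<Rightarrow> 'a::banach" where
  "averaged f s t x = integral {s..t} (\<lambda>r. f r x)"

locale bounded_continuous_field =
  fixes f :: "real \<Rightarrow> 'a::euclidean_space \<Rightarrow> 'a" and T M :: real
  assumes duration_nonneg: "0 \<le> T"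
    and continuous_field: "continuous_on ({0..T} \<times> UNIV) (\<lambda>(r, x). f r x)"
    and field_bound: "r \<in> {0..T} \<Longrightarrow> norm (f r x) \<le> M"
begin

lemma bound_nonneg: "0 \<le> M"
  using field_bound[of 0 0] duration_nonneg by (auto intro: order_trans[OF norm_ge_zero])

lemma continuous_on_field:
  assumes "continuous_on S \<tau>" "continuous_on S \<theta>" "\<tau> ` S \<subseteq> {0..T}"
  shows "continuous_on S (\<lambda>p. f (\<tau> p) (\<theta> p))"
proof -
  have "continuous_on S (\<lambda>p. (\<lambda>(r, x). f r x) (\<tau> p, \<theta> p))"
    using assms by (intro continuous_on_compose2[OF continuous_field] continuous_intros) auto
  then show ?thesis by simp
qed

lemma continuous_on_field_along:
  assumes "continuous_on {s..t} \<theta>" "0 \<le> s" "t \<le> T"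
  shows "continuous_on {s..t} (\<lambda>r. f r (\<theta> r))"
  using assms by (intro continuous_on_field) auto

lemmas integrable_field_along = integrable_continuous_interval[OF continuous_on_field_along]

lemma isCont_field: "r \<in> {0..T} \<Longrightarrow> isCont (f r) x"
  using continuous_on_field[of UNIV "\<lambda>_. r" "\<lambda>x. x"] by (simp add: continuous_on_eq_continuous_at)

lemma averaged_split:
  assumes "0 \<le> s" "s \<le> u" "u \<le> t" "t \<le> T"
  shows "averaged f s t x = averaged f s u x + averaged f u t x"
  using integral_increment[OF integrable_field_along, of s t "\<lambda>_. x" u] assms
  by (simp add: averaged_def algebra_simps)

lemma integral_curve_increment:
  assumes "integral_curve f T x\<^sub>0 \<theta>" "0 \<le> s" "s \<le> t" "t \<le> T"
  shows "\<theta> t - \<theta> s = integral {s..t} (\<lambda>r. f r (\<theta> r))"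
proof -
  have "integral {0..t} (\<lambda>r. f r (\<theta> r)) - integral {0..s} (\<lambda>r. f r (\<theta> r)) =
      integral {s..t} (\<lambda>r. f r (\<theta> r))"
    using assms
    by (intro integral_increment integrable_field_along integral_curve_continuous_on) auto
  then show ?thesis using assms by (simp add: integral_curve_def)
qed

lemma integral_curve_lipschitz_on:
  assumes \<theta>: "integral_curve f T x\<^sub>0 \<theta>"
  shows "M-lipschitz_on {0..T} \<theta>"
proof -
  have "M-lipschitz_on {0..T} (\<lambda>t. integral {0..t} (\<lambda>r. f r (\<theta> r)))"
    using integral_curve_continuous_on[OF \<theta>] field_bound bound_nonneg
    by (intro lipschitz_on_integral continuous_on_field_along) auto
  then show ?thesis
    using \<theta> by (auto simp: integral_curve_def lipschitz_on_def)
qed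

lemma integral_curve_in_cball:
  assumes \<theta>: "integral_curve f T x\<^sub>0 \<theta>" and t: "t \<in> {0..T}"
  shows "\<theta> t \<in> cball x\<^sub>0 (M * T)"
  using lipschitz_on_interval_in_cball[OF integral_curve_lipschitz_on[OF \<theta>] t]
    integral_curve_initial[OF \<theta> duration_nonneg] by simp

lemma negligible_germ_on_integral_curve:
  assumes \<theta>: "integral_curve f T x\<^sub>0 \<theta>"
  shows "negligible_germ_on {0..T} (\<lambda>s t. \<theta> t - \<theta> s - averaged f s t (\<theta> s))"
  unfolding negligible_germ_on_def
proof (intro allI impI)
  fix \<epsilon> :: real assume "0 < \<epsilon>"
  define F where "F p = f (snd p) (\<theta> (fst p))" for p
  have "continuous_on ({0..T} \<times> {0..T}) F"
    unfolding F_def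
    by (intro continuous_on_field continuous_intros
        continuous_on_compose2[OF integral_curve_continuous_on[OF \<theta> order_refl]]) auto
  then have "uniformly_continuous_on ({0..T} \<times> {0..T}) F"
    by (intro compact_uniformly_continuous compact_Times) auto
  then obtain \<delta> where "0 < \<delta>" and F_close: "\<And>p q. p \<in> {0..T} \<times> {0..T} \<Longrightarrow> q \<in> {0..T} \<times> {0..T} \<Longrightarrow>
      dist q p < \<delta> \<Longrightarrow> dist (F q) (F p) < \<epsilon>"
    using \<open>0 < \<epsilon>\<close> unfolding uniformly_continuous_on_def by metis
  have "norm (\<theta> t - \<theta> s - averaged f s t (\<theta> s)) \<le> \<epsilon> * (t - s)"
    if st: "s \<in> {0..T}" "t \<in> {0..T}" "s < t" "t - s \<le> \<delta> / 2" for s t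
  proof -
    have cont: "continuous_on {s..t} (\<lambda>r. f r (\<theta> r))" "continuous_on {s..t} (\<lambda>r. f r (\<theta> s))"
      using st by (auto intro!: continuous_on_field_along integral_curve_continuous_on[OF \<theta>])
    then have "\<theta> t - \<theta> s - averaged f s t (\<theta> s) = integral {s..t} (\<lambda>r. f r (\<theta> r) - f r (\<theta> s))"
      using st integral_curve_increment[OF \<theta>, of s t]
      by (simp add: averaged_def integrable_continuous_interval
          Henstock_Kurzweil_Integration.integral_diff)
    also have "norm \<dots> \<le> \<epsilon> * (t - s)"
    proof (rule integral_bound)
      fix r assume r: "r \<in> {s..t}"
      have "dist (F (r, r)) (F (s, r)) < \<epsilon>"
        using r st \<open>0 < \<delta>\<close> by (intro F_close) (auto simp: dist_prod_def dist_real_def)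
      then show "norm (f r (\<theta> r) - f r (\<theta> s)) \<le> \<epsilon>" by (simp add: F_def dist_norm)
    qed (use st cont in \<open>auto intro: continuous_on_diff\<close>)
    finally show ?thesis .
  qed
  then show "\<exists>\<delta>>0. \<forall>s\<in>{0..T}. \<forall>t\<in>{0..T}. s < t \<longrightarrow> t - s \<le> \<delta> \<longrightarrow>
      norm (\<theta> t - \<theta> s - averaged f s t (\<theta> s)) \<le> \<epsilon> * (t - s)"
    using \<open>0 < \<delta>\<close> by (intro exI[of _ "\<delta> / 2"]) auto
qed

subsection \<open>Peano's existence theorem\<close>

text \<open>Tonelli's scheme: with the delay \<open>h\<close> in the argument the iteration becomes stationary on
  \<open>[0, k h]\<close> after \<open>k\<close> steps, and the delayed equation is solved without a limit.\<close>
primrec delayed_iterate :: "real \<Rightarrow> 'a \<Rightarrow> nat \<Rightarrow> real \<Rightarrow> 'a" where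
  "delayed_iterate h x\<^sub>0 0 = (\<lambda>t. x\<^sub>0)"
| "delayed_iterate h x\<^sub>0 (Suc k) =
     (\<lambda>t. x\<^sub>0 + integral {0..t} (\<lambda>r. f r (delayed_iterate h x\<^sub>0 k (max 0 (r - h)))))"

lemma continuous_on_delayed_field:
  assumes "continuous_on {0..T} \<theta>" "0 \<le> h" "t \<le> T"
  shows "continuous_on {0..t} (\<lambda>r. f r (\<theta> (max 0 (r - h))))"
  using assms
  by (intro continuous_on_field_along continuous_on_compose2[OF assms(1)] continuous_intros) auto

lemma lipschitz_on_delayed_iterate:
  assumes "0 \<le> h"
  shows "M-lipschitz_on {0..T} (delayed_iterate h x\<^sub>0 k)"
proof (induction k)
  case 0
  show ?case using bound_nonneg by (simp add: lipschitz_on_def)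
next
  case (Suc k)
  have "M-lipschitz_on {0..T}
      (\<lambda>t. integral {0..t} (\<lambda>r. f r (delayed_iterate h x\<^sub>0 k (max 0 (r - h)))))"
    using assms lipschitz_on_continuous_on[OF Suc.IH] field_bound bound_nonneg
    by (intro lipschitz_on_integral continuous_on_delayed_field) auto
  then show ?case by (simp add: lipschitz_on_def)
qed

lemma delayed_iterate_stationary:
  assumes "0 \<le> h" "0 \<le> t" "t \<le> real k * h"
  shows "delayed_iterate h x\<^sub>0 (Suc k) t = delayed_iterate h x\<^sub>0 k t"
  using assms(2,3)
proof (induction k arbitrary: t)
  case 0
  then show ?case by simp
next
  case (Suc k)
  have "delayed_iterate h x\<^sub>0 (Suc k) (max 0 (r - h)) = delayed_iterate h x\<^sub>0 k (max 0 (r - h))"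
    if "r \<in> {0..t}" for r
    using that Suc.prems \<open>0 \<le> h\<close> by (intro Suc.IH) (auto simp: algebra_simps)
  then have "integral {0..t} (\<lambda>r. f r (delayed_iterate h x\<^sub>0 (Suc k) (max 0 (r - h)))) =
      integral {0..t} (\<lambda>r. f r (delayed_iterate h x\<^sub>0 k (max 0 (r - h))))"
    by (intro integral_cong) (simp del: delayed_iterate.simps)
  then show ?case by (subst (1 2) delayed_iterate.simps(2)) (simp del: delayed_iterate.simps)
qed

definition delayed_curve :: "real \<Rightarrow> 'a \<Rightarrow> real \<Rightarrow> 'a" where
  "delayed_curve h x\<^sub>0 = delayed_iterate h x\<^sub>0 (nat \<lceil>T / h\<rceil>)"

lemma lipschitz_on_delayed_curve: "0 \<le> h \<Longrightarrow> M-lipschitz_on {0..T} (delayed_curve h x\<^sub>0)"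
  unfolding delayed_curve_def by (rule lipschitz_on_delayed_iterate)

lemma delayed_curve_eq:
  assumes "0 < h" "t \<in> {0..T}"
  shows "delayed_curve h x\<^sub>0 t =
    x\<^sub>0 + integral {0..t} (\<lambda>r. f r (delayed_curve h x\<^sub>0 (max 0 (r - h))))"
  using assms le_nat_ceiling_divide_mult[of h T] delayed_iterate_stationary[of h t "nat \<lceil>T / h\<rceil>"]
  by (simp add: delayed_curve_def)

lemma delayed_curve_in_cball:
  assumes "0 < h" and t: "t \<in> {0..T}"
  shows "delayed_curve h x\<^sub>0 t \<in> cball x\<^sub>0 (M * T)"
proof -
  have "delayed_curve h x\<^sub>0 t \<in> cball (delayed_curve h x\<^sub>0 0) (M * (T - 0))"
    using assms by (intro lipschitz_on_interval_in_cball lipschitz_on_delayed_curve) auto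
  then show ?thesis using delayed_curve_eq[of h 0] \<open>0 < h\<close> duration_nonneg by simp
qed

lemma tendsto_vanishing_delay:
  fixes \<Theta> :: "nat \<Rightarrow> real \<Rightarrow> 'a"
  assumes lip: "\<And>n. M-lipschitz_on {0..T} (\<Theta> n)" and lim: "(\<lambda>n. \<Theta> n t) \<longlonglongrightarrow> \<theta> t"
    and h: "h \<longlonglongrightarrow> 0" "\<And>n. 0 \<le> h n" and t: "t \<in> {0..T}"
  shows "(\<lambda>n. \<Theta> n (max 0 (t - h n))) \<longlonglongrightarrow> \<theta> t"
proof (rule Lim_transform[OF lim])
  show "(\<lambda>n. \<Theta> n (max 0 (t - h n)) - \<Theta> n t) \<longlonglongrightarrow> 0"
  proof (rule Lim_null_comparison)
    have "norm (\<Theta> n (max 0 (t - h n)) - \<Theta> n t) \<le> M * h n" for n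
    proof -
      have "norm (\<Theta> n (max 0 (t - h n)) - \<Theta> n t) \<le> M * dist (max 0 (t - h n)) t"
        unfolding dist_norm[symmetric] using h(2)[of n] t by (intro lipschitz_onD[OF lip]) auto
      also have "\<dots> \<le> M * h n"
        using h(2)[of n] t bound_nonneg by (intro mult_left_mono) (auto simp: dist_real_def)
      finally show ?thesis .
    qed
    then show "\<forall>\<^sub>F n in sequentially. norm (\<Theta> n (max 0 (t - h n)) - \<Theta> n t) \<le> M * h n"
      by (rule always_eventually[OF allI])
    show "(\<lambda>n. M * h n) \<longlonglongrightarrow> 0" using tendsto_mult_left[OF h(1), of M] by simp
  qed
qed

lemma integral_curve_limit_of_delayed:
  assumes lip: "\<And>n. M-lipschitz_on {0..T} (\<Theta> n)"
    and delayed: "\<And>n t. t \<in> {0..T} \<Longrightarrow>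
      \<Theta> n t = x\<^sub>0 + integral {0..t} (\<lambda>r. f r (\<Theta> n (max 0 (r - h n))))"
    and h: "h \<longlonglongrightarrow> 0" "\<And>n. 0 \<le> h n"
    and \<theta>: "continuous_on {0..T} \<theta>" and lim: "\<And>t. t \<in> {0..T} \<Longrightarrow> (\<lambda>n. \<Theta> n t) \<longlonglongrightarrow> \<theta> t"
  shows "integral_curve f T x\<^sub>0 \<theta>"
  unfolding integral_curve_def
proof (intro conjI ballI \<theta>)
  fix t assume t: "t \<in> {0..T}"
  have "(\<lambda>n. integral {0..t} (\<lambda>r. f r (\<Theta> n (max 0 (r - h n))))) \<longlonglongrightarrow> integral {0..t} (\<lambda>r. f r (\<theta> r))"
  proof (rule dominated_convergence(2)[where h = "\<lambda>_. M"])
    show "(\<lambda>r. f r (\<Theta> n (max 0 (r - h n)))) integrable_on {0..t}" for n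
      using t h(2) lipschitz_on_continuous_on[OF lip]
      by (intro integrable_continuous_interval continuous_on_delayed_field) auto
    show "(\<lambda>n. f r (\<Theta> n (max 0 (r - h n)))) \<longlonglongrightarrow> f r (\<theta> r)" if "r \<in> {0..t}" for r
      using that t lim
      by (intro isCont_tendsto_compose[OF isCont_field] tendsto_vanishing_delay[OF lip _ h]) auto
  qed (use t field_bound in auto)
  then have "(\<lambda>n. x\<^sub>0 + integral {0..t} (\<lambda>r. f r (\<Theta> n (max 0 (r - h n))))) \<longlonglongrightarrow>
      x\<^sub>0 + integral {0..t} (\<lambda>r. f r (\<theta> r))"
    by (intro tendsto_intros)
  then show "\<theta> t = x\<^sub>0 + integral {0..t} (\<lambda>r. f r (\<theta> r))"
    using LIMSEQ_unique[OF lim[OF t]] delayed[OF t] by simp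
qed

theorem integral_curve_exists: "\<exists>\<theta>. integral_curve f T x\<^sub>0 \<theta>"
proof -
  define h :: "nat \<Rightarrow> real" where "h n = inverse (real (Suc n))" for n
  define \<Theta> where "\<Theta> n = delayed_curve (h n) x\<^sub>0" for n
  have h_pos: "0 < h n" for n by (simp add: h_def)
  have lip: "M-lipschitz_on {0..T} (\<Theta> n)" for n
    unfolding \<Theta>_def by (intro lipschitz_on_delayed_curve less_imp_le h_pos)
  have delayed: "\<Theta> n t = x\<^sub>0 + integral {0..t} (\<lambda>r. f r (\<Theta> n (max 0 (r - h n))))"
    if "t \<in> {0..T}" for n t
    unfolding \<Theta>_def by (rule delayed_curve_eq[OF h_pos that])
  have bound: "norm (\<Theta> n t) \<le> norm x\<^sub>0 + M * T" if "t \<in> {0..T}" for n t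
    using delayed_curve_in_cball[OF h_pos[of n] that, of x\<^sub>0] norm_triangle_sub[of "\<Theta> n t" x\<^sub>0]
    by (simp add: \<Theta>_def dist_norm norm_minus_commute)
  obtain \<theta> k where \<theta>: "continuous_on {0..T} \<theta>" and k: "strict_mono (k :: nat \<Rightarrow> nat)"
    and lim: "uniform_limit {0..T} (\<lambda>n. \<Theta> (k n)) \<theta> sequentially"
    by (rule lipschitz_sequence_uniform_limit[of "{0..T}" M \<Theta>, OF compact_Icc lip])
      (use bound in blast)+
  have "(\<lambda>n. h (k n)) \<longlonglongrightarrow> 0"
    using LIMSEQ_subseq_LIMSEQ[OF LIMSEQ_inverse_real_of_nat k] by (simp add: h_def o_def)
  then have "integral_curve f T x\<^sub>0 \<theta>"
    using lip delayed h_pos[THEN less_imp_le] \<theta> tendsto_uniform_limitI[OF lim]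
    by (intro integral_curve_limit_of_delayed[of "\<lambda>n. \<Theta> (k n)" _ "\<lambda>n. h (k n)"]) auto
  then show ?thesis by blast
qed

end

section \<open>Stability of integral curves\<close>

lemma geometric_growth_of_short_time_bound:
  fixes \<phi> :: "real \<Rightarrow> real"
  assumes short: "\<And>a t. 0 \<le> a \<Longrightarrow> a \<le> t \<Longrightarrow> t \<le> T \<Longrightarrow> t - a \<le> \<tau> \<Longrightarrow> \<phi> t \<le> c * \<phi> a"
    and "0 \<le> c" and t: "0 \<le> t" "t \<le> T" "t \<le> real n * \<tau>"
  shows "\<phi> t \<le> c ^ n * \<phi> 0"
proof (cases "n = 0")
  case True
  then show ?thesis using t by simp
next
  case False
  define h where "h = t / n"
  have h: "real n * h = t" "0 \<le> h" "h \<le> \<tau>" using False t by (simp_all add: h_def field_simps)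
  have "\<phi> (real k * h) \<le> c ^ k * \<phi> 0" if "k \<le> n" for k
    using that
  proof (induction k)
    case 0
    then show ?case by simp
  next
    case (Suc k)
    have "real (Suc k) * h \<le> real n * h"
      using Suc.prems h(2) by (intro mult_right_mono) auto
    then have "\<phi> (real (Suc k) * h) \<le> c * \<phi> (real k * h)"
      using h t by (intro short) (auto simp: algebra_simps)
    also have "\<dots> \<le> c * (c ^ k * \<phi> 0)"
      using Suc.IH Suc.prems \<open>0 \<le> c\<close> by (intro mult_left_mono) auto
    finally show ?case by simp
  qed
  from this[of n] h(1) show ?thesis by simp
qed

lemma mult_powr_le_half:
  fixes B \<beta> d :: real
  assumes "0 \<le> B" "0 < \<beta>" "0 \<le> d" "d \<le> (1 / (2 * B + 2)) powr (1 / \<beta>)"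
  shows "B * d powr \<beta> \<le> 1 / 2"
proof -
  have "d powr \<beta> \<le> ((1 / (2 * B + 2)) powr (1 / \<beta>)) powr \<beta>"
    using assms by (intro powr_mono2) auto
  also have "\<dots> = 1 / (2 * B + 2)" using assms by (simp add: powr_powr)
  finally have "B * d powr \<beta> \<le> B * (1 / (2 * B + 2))" using assms(1) by (intro mult_left_mono)
  also have "\<dots> \<le> 1 / 2" using assms(1) by (simp add: field_simps)
  finally show ?thesis .
qed

locale regularized_field = bounded_continuous_field f T M
  for f :: "real \<Rightarrow> 'a::euclidean_space \<Rightarrow> 'a" and T M +
  fixes X :: "'a set" and L \<alpha> \<gamma> :: real
  assumes convex_domain: "convex X"
    and exponents: "0 < \<alpha>" "\<alpha> \<le> 1" "\<alpha> < \<gamma>" "1 < \<alpha> + \<gamma>"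
    and regularity_nonneg: "0 \<le> L"
    and averaged_regularity: "\<lbrakk>0 \<le> s; s < t; t \<le> T\<rbrakk> \<Longrightarrow>
      C1_holder_on \<alpha> (L * (t - s) powr \<gamma>) X (averaged f s t)"
begin

definition improvement_constant :: real where
  "improvement_constant = L * (1 + (1 + M powr \<alpha>) * sewing_constant (\<alpha> + \<gamma>))"

definition doubling_time :: real where
  "doubling_time = (1 / (2 * improvement_constant + 2)) powr (1 / (\<gamma> - \<alpha>))"

lemma improvement_constant_nonneg: "0 \<le> improvement_constant"
  using regularity_nonneg exponents
  by (simp add: improvement_constant_def sewing_constant_nonneg)

lemma doubling_time_pos: "0 < doubling_time"
  using improvement_constant_nonneg by (simp add: doubling_time_def)

lemma doubling_time_le_1: "doubling_time \<le> 1"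
  unfolding doubling_time_def using improvement_constant_nonneg exponents by (intro powr_le1) auto

end

locale regularized_curve_pair = regularized_field +
  fixes x\<^sub>0 y\<^sub>0 :: 'a and \<theta> \<eta> :: "real \<Rightarrow> 'a"
  assumes curves: "integral_curve f T x\<^sub>0 \<theta>" "integral_curve f T y\<^sub>0 \<eta>"
    and curves_in_domain: "t \<in> {0..T} \<Longrightarrow> \<theta> t \<in> X" "t \<in> {0..T} \<Longrightarrow> \<eta> t \<in> X"
begin

definition separation :: "real \<Rightarrow> 'a" where
  "separation t = \<theta> t - \<eta> t"

definition germ :: "real \<Rightarrow> real \<Rightarrow> 'a" where
  "germ s t = averaged f s t (\<theta> s) - averaged f s t (\<eta> s)"

lemma separation_0: "separation 0 = x\<^sub>0 - y\<^sub>0"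
  using integral_curve_initial[OF curves(1) duration_nonneg]
    integral_curve_initial[OF curves(2) duration_nonneg]
  by (simp add: separation_def)

lemma separation_lipschitz_on: "(M + M)-lipschitz_on {0..T} separation"
  unfolding separation_def[abs_def]
  using curves by (intro lipschitz_on_diff integral_curve_lipschitz_on)

lemma germ_approximates_separation:
  "negligible_germ_on {0..T} (\<lambda>s t. separation t - separation s - germ s t)"
proof -
  have "separation t - separation s - germ s t =
      (\<theta> t - \<theta> s - averaged f s t (\<theta> s)) - (\<eta> t - \<eta> s - averaged f s t (\<eta> s))" for s t
    by (simp add: separation_def germ_def)
  then show ?thesis
    using curves by (simp only:) (intro negligible_germ_on_diff negligible_germ_on_integral_curve)
qed

lemma norm_germ_le:
  assumes "0 \<le> s" "s < t" "t \<le> T"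
  shows "norm (germ s t) \<le> L * (t - s) powr \<gamma> * norm (separation s)"
proof -
  have "(L * (t - s) powr \<gamma>)-lipschitz_on X (averaged f s t)"
    using averaged_regularity[OF assms] convex_domain by (rule C1_holder_on_imp_lipschitz_on)
  then show ?thesis
    unfolding germ_def separation_def
    by (rule lipschitz_on_normD) (use assms curves_in_domain in auto)
qed

lemma germ_defect:
  assumes "0 \<le> s" "s \<le> u" "u \<le> t" "t \<le> T"
  shows "germ s t - germ s u - germ u t =
    (averaged f u t (\<theta> s) - averaged f u t (\<eta> s)) - (averaged f u t (\<theta> u) - averaged f u t (\<eta> u))"
  using averaged_split[OF assms] by (simp add: germ_def)

lemma norm_germ_defect_le:
  assumes stu: "0 \<le> s" "s < u" "u < t" "t \<le> T"
    and S: "norm (separation u) \<le> S" "norm (separation s - separation u) \<le> S * (t - s) powr \<alpha>"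
  shows "norm (germ s t - germ s u - germ u t) \<le> L * (1 + M powr \<alpha>) * S * (t - s) powr (\<alpha> + \<gamma>)"
proof -
  have close: "norm (\<zeta> s - \<zeta> u) \<le> M * (t - s)" if "M-lipschitz_on {0..T} \<zeta>" for \<zeta> :: "real \<Rightarrow> 'a"
  proof -
    have "norm (\<zeta> s - \<zeta> u) \<le> M * norm (s - u)" using that stu by (intro lipschitz_on_normD) auto
    also have "\<dots> \<le> M * (t - s)" using stu bound_nonneg by (intro mult_left_mono) auto
    finally show ?thesis .
  qed
  have "0 \<le> S" using S(1) norm_ge_zero order_trans by blast
  have "norm (germ s t - germ s u - germ u t) \<le> (L * (t - u) powr \<gamma>) *
      (norm ((\<theta> s - \<eta> s) - (\<theta> u - \<eta> u)) + (M * (t - s)) powr \<alpha> * norm (\<theta> u - \<eta> u))"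
    using stu exponents curves_in_domain curves[THEN integral_curve_lipschitz_on, THEN close]
    by (subst germ_defect)
      (auto intro!: C1_holder_on_second_difference[OF averaged_regularity] convex_domain)
  also have "\<dots> \<le> (L * (t - s) powr \<gamma>) * (S * (t - s) powr \<alpha> + (M * (t - s)) powr \<alpha> * S)"
    using stu S \<open>0 \<le> S\<close> regularity_nonneg bound_nonneg exponents
    by (intro mult_mono add_mono powr_mono2) (auto simp: separation_def)
  also have "\<dots> = L * (1 + M powr \<alpha>) * S * (t - s) powr (\<alpha> + \<gamma>)"
    unfolding powr_mult powr_add by (simp add: algebra_simps)
  finally show ?thesis .
qed

lemma norm_separation_le_holder:
  assumes "holder_on \<alpha> Q {a..c} separation" "u \<in> {a..c}" "c - a \<le> 1"
  shows "norm (separation u) \<le> norm (separation a) + Q"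
proof -
  have "norm (separation u - separation a) \<le> Q * dist u a powr \<alpha>"
    using holder_onD[OF assms(1), of u a] assms(2) by (simp add: dist_norm)
  also have "\<dots> \<le> Q * 1"
    using assms exponents holder_on_nonneg
    by (intro mult_left_mono powr_le1) (auto simp: dist_real_def)
  finally show ?thesis using norm_triangle_sub[of "separation u" "separation a"] by simp
qed

lemma separation_remainder_le:
  assumes ac: "0 \<le> a" "c \<le> T" "c - a \<le> 1" and Q: "holder_on \<alpha> Q {a..c} separation"
    and st: "a \<le> s" "s < t" "t \<le> c"
  shows "norm (separation t - separation s - germ s t) \<le>
    L * (1 + M powr \<alpha>) * (norm (separation a) + Q) * sewing_constant (\<alpha> + \<gamma>) *
      (t - s) powr (\<alpha> + \<gamma>)"
proof (rule sewing_bound[where a = a and c = c])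
  have "0 \<le> Q" using Q by (rule holder_on_nonneg)
  then show "0 \<le> L * (1 + M powr \<alpha>) * (norm (separation a) + Q)" using regularity_nonneg by simp
  show "negligible_germ_on {a..c} (\<lambda>s t. separation t - separation s - germ s t)"
    using ac by (intro negligible_germ_on_subset[OF germ_approximates_separation]) auto
  fix s u t assume stu: "a \<le> s" "s < u" "u < t" "t \<le> c"
  have "norm (separation s - separation u) \<le> Q * dist s u powr \<alpha>"
    unfolding dist_norm[symmetric] using stu by (intro holder_onD[OF Q]) auto
  also have "\<dots> \<le> (norm (separation a) + Q) * (t - s) powr \<alpha>"
    using stu \<open>0 \<le> Q\<close> exponents by (intro mult_mono powr_mono2) (auto simp: dist_real_def)
  finally show "norm (germ s t - germ s u - germ u t) \<le>
      L * (1 + M powr \<alpha>) * (norm (separation a) + Q) * (t - s) powr (\<alpha> + \<gamma>)"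
    using stu ac by (intro norm_germ_defect_le norm_separation_le_holder[OF Q]) auto
qed (use exponents st in auto)

lemma holder_constant_improvement:
  assumes ac: "0 \<le> a" "a \<le> c" "c \<le> T" "c - a \<le> 1" and Q: "holder_on \<alpha> Q {a..c} separation"
  shows "holder_on \<alpha> (improvement_constant * (c - a) powr (\<gamma> - \<alpha>) * (norm (separation a) + Q))
    {a..c} separation"
proof (rule holder_on_lessI)
  define S where "S = norm (separation a) + Q"
  define C where "C = L * (1 + M powr \<alpha>) * sewing_constant (\<alpha> + \<gamma>)"
  have "0 \<le> S" using holder_on_nonneg[OF Q] by (simp add: S_def)
  have "0 \<le> C" using regularity_nonneg exponents by (simp add: C_def sewing_constant_nonneg)
  show "0 \<le> improvement_constant * (c - a) powr (\<gamma> - \<alpha>) * (norm (separation a) + Q)"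
    using improvement_constant_nonneg \<open>0 \<le> S\<close> by (simp add: S_def)
  fix s t assume st: "s \<in> {a..c}" "t \<in> {a..c}" "s < t"
  have "norm (germ s t) \<le> L * (t - s) powr \<gamma> * norm (separation s)"
    using st ac by (intro norm_germ_le) auto
  also have "\<dots> \<le> L * (t - s) powr \<gamma> * S"
    unfolding S_def using st ac regularity_nonneg
    by (intro mult_left_mono norm_separation_le_holder[OF Q]) auto
  finally have germ: "norm (germ s t) \<le> L * (t - s) powr \<gamma> * S" .
  have "norm (separation t - separation s - germ s t) \<le> C * S * (t - s) powr (\<alpha> + \<gamma>)"
    using separation_remainder_le[OF ac(1,3,4) Q, of s t] st by (simp add: C_def S_def mult_ac)
  also have "\<dots> \<le> C * S * (t - s) powr \<gamma>"
    using \<open>0 \<le> S\<close> \<open>0 \<le> C\<close> st ac exponents by (intro mult_left_mono powr_mono') auto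
  finally have "dist (separation s) (separation t) \<le>
      L * (t - s) powr \<gamma> * S + C * S * (t - s) powr \<gamma>"
    using germ norm_triangle_sub[of "separation t - separation s" "germ s t"]
    by (simp add: dist_norm norm_minus_commute)
  also have "\<dots> = improvement_constant * S * ((t - s) powr (\<gamma> - \<alpha>) * (t - s) powr \<alpha>)"
    by (simp add: improvement_constant_def C_def algebra_simps flip: powr_add)
  also have "\<dots> \<le> improvement_constant * S * ((c - a) powr (\<gamma> - \<alpha>) * (t - s) powr \<alpha>)"
    using improvement_constant_nonneg \<open>0 \<le> S\<close> st exponents
    by (intro mult_left_mono mult_right_mono powr_mono2) auto
  finally show "dist (separation s) (separation t) \<le>
      improvement_constant * (c - a) powr (\<gamma> - \<alpha>) * (norm (separation a) + Q) * (t - s) powr \<alpha>"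
    by (simp add: S_def mult_ac)
qed

lemma norm_separation_doubling:
  assumes at: "0 \<le> a" "a \<le> t" "t \<le> T" "t - a \<le> doubling_time"
  shows "norm (separation t) \<le> 2 * norm (separation a)"
proof -
  have short: "t - a \<le> 1" using at doubling_time_le_1 by simp
  have "(M + M)-lipschitz_on {a..t} separation"
    using at by (intro lipschitz_on_subset[OF separation_lipschitz_on]) auto
  then have initial: "holder_on \<alpha> (M + M) {a..t} separation"
    using short exponents by (intro lipschitz_on_imp_holder_on) (auto simp: dist_real_def)
  have "holder_on \<alpha> (1 / 2 * (norm (separation a) + Q)) {a..t} separation"
    if Q: "holder_on \<alpha> Q {a..t} separation" for Q
  proof (rule holder_on_mono[OF holder_constant_improvement[OF at(1-3) short Q]])
    have "improvement_constant * (t - a) powr (\<gamma> - \<alpha>) \<le> 1 / 2"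
      using at exponents improvement_constant_nonneg
      by (intro mult_powr_le_half) (auto simp: doubling_time_def)
    then show "improvement_constant * (t - a) powr (\<gamma> - \<alpha>) * (norm (separation a) + Q) \<le>
        1 / 2 * (norm (separation a) + Q)"
      using holder_on_nonneg[OF Q] by (intro mult_right_mono) auto
  qed
  from holder_on_self_improvement[OF initial _ _ this]
  have "holder_on \<alpha> (norm (separation a)) {a..t} separation" by simp
  then show ?thesis using norm_separation_le_holder[of "norm (separation a)" a t t] at short by simp
qed

lemma norm_separation_le:
  assumes t: "t \<in> {0..T}"
  shows "norm (separation t) \<le> 2 ^ nat \<lceil>T / doubling_time\<rceil> * norm (x\<^sub>0 - y\<^sub>0)"
proof -
  have "T \<le> real (nat \<lceil>T / doubling_time\<rceil>) * doubling_time"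
    using doubling_time_pos by (rule le_nat_ceiling_divide_mult)
  then have "norm (separation t) \<le> 2 ^ nat \<lceil>T / doubling_time\<rceil> * norm (separation 0)"
    using t norm_separation_doubling
    by (intro geometric_growth_of_short_time_bound[where \<tau> = doubling_time and T = T]) auto
  then show ?thesis by (simp add: separation_0)
qed

end

theorem (in regularized_field) integral_curve_stability:
  assumes "integral_curve f T x\<^sub>0 \<theta>" "integral_curve f T y\<^sub>0 \<eta>"
    and "\<theta> ` {0..T} \<subseteq> X" "\<eta> ` {0..T} \<subseteq> X" and "t \<in> {0..T}"
  shows "norm (\<theta> t - \<eta> t) \<le> 2 ^ nat \<lceil>T / doubling_time\<rceil> * norm (x\<^sub>0 - y\<^sub>0)"
proof -
  interpret regularized_curve_pair f T M X L \<alpha> \<gamma> x\<^sub>0 y\<^sub>0 \<theta> \<eta>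
    using assms by unfold_locales auto
  show ?thesis using norm_separation_le[OF \<open>t \<in> {0..T}\<close>] by (simp add: separation_def)
qed

section \<open>The equation driven by a path\<close>

lemma ennreal_le_mult_of_divide_le:
  fixes x y z :: ennreal
  assumes "x / y \<le> z" "y < top" "z < top"
  shows "x \<le> z * y"
proof (cases "y = 0")
  case True
  then show ?thesis using assms by (auto simp: top_unique split: if_splits)
next
  case False
  then have "x = x / y * y"
    using \<open>y < top\<close> by (simp add: ennreal_divide_times)
  then show ?thesis using assms(1) by (metis mult_right_mono zero_le)
qed

lemma weight_nonneg: "weight \<psi> \<Longrightarrow> 0 \<le> r \<Longrightarrow> 0 \<le> \<psi> r"
  by (simp add: weight_def)

lemma weight_mono: "weight \<psi> \<Longrightarrow> 0 \<le> r \<Longrightarrow> r \<le> r' \<Longrightarrow> \<psi> r \<le> \<psi> r'"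
  by (simp add: weight_def mono_on_def)

lemma cont_diff_has_derivative:
  assumes "cont_diff g"
  shows "(g has_derivative blinfun_apply (total_deriv g x)) (at x)"
proof -
  have "(g has_derivative frechet_derivative g (at x)) (at x)"
    using assms by (simp add: cont_diff_def frechet_derivative_works)
  then show ?thesis
    by (metis bounded_linear_Blinfun_apply has_derivative_bounded_linear total_deriv_def)
qed

lemma C32_norm_le_imp_bounds:
  assumes norm: "C32_norm \<psi> g \<le> ennreal k" and "0 \<le> k" "weight \<psi>"
  shows "cont_diff g" and "norm (total_deriv g 0) \<le> k"
    and "norm (total_deriv g x - total_deriv g y) \<le>
      k * (norm (x - y) powr (1/2) * \<psi> (norm x + norm y))"
proof -
  define seminorm where "seminorm = (SUP (x, y) \<in> {(x, y). x \<noteq> y}.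
    ennreal (norm (total_deriv g x - total_deriv g y)) /
    ennreal (norm (x - y) powr (1/2) * \<psi> (norm x + norm y)))"
  show "cont_diff g"
    using norm by (auto simp: C32_norm_def top_unique split: if_splits)
  then have norm_sum_le:
    "seminorm + ennreal (norm (g 0)) + ennreal (norm (total_deriv g 0)) \<le> ennreal k"
    using norm by (simp add: C32_norm_def seminorm_def)
  have "ennreal (norm (total_deriv g 0)) \<le> ennreal k"
    by (rule order_trans[OF _ norm_sum_le]) (simp add: add_increasing)
  then show "norm (total_deriv g 0) \<le> k" using \<open>0 \<le> k\<close> by simp
  show "norm (total_deriv g x - total_deriv g y) \<le>
      k * (norm (x - y) powr (1/2) * \<psi> (norm x + norm y))"
  proof (cases "x = y")
    case False
    define d where "d = norm (x - y) powr (1/2) * \<psi> (norm x + norm y)"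
    have "0 \<le> d" using weight_nonneg[OF \<open>weight \<psi>\<close>] by (simp add: d_def)
    have "ennreal (norm (total_deriv g x - total_deriv g y)) / ennreal d \<le> seminorm"
      unfolding seminorm_def by (rule SUP_upper2[of "(x, y)"]) (use False in \<open>auto simp: d_def\<close>)
    also have "\<dots> \<le> ennreal k"
      by (rule order_trans[OF _ norm_sum_le]) (simp add: add.assoc)
    finally have "ennreal (norm (total_deriv g x - total_deriv g y)) \<le> ennreal k * ennreal d"
      by (rule ennreal_le_mult_of_divide_le) auto
    then show ?thesis using \<open>0 \<le> k\<close> \<open>0 \<le> d\<close> by (simp add: d_def flip: ennreal_mult)
  qed simp
qed

lemma C32_norm_le_imp_C1_holder_on:
  fixes g :: "real ^ 'n \<Rightarrow> real ^ 'n"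
  assumes norm: "C32_norm \<psi> g \<le> ennreal k" and k: "0 \<le> k" and \<psi>: "weight \<psi>" and "0 \<le> R"
  shows "C1_holder_on (1/2) (k * (1 + (1 + R powr (1/2)) * \<psi> (2 * R))) (cball 0 R) g"
proof -
  note bounds = C32_norm_le_imp_bounds[OF norm k \<psi>]
  define D where "D = total_deriv g"
  define L where "L = k * (1 + (1 + R powr (1/2)) * \<psi> (2 * R))"
  have nonneg: "0 \<le> k * \<psi> (2 * R)" "0 \<le> k * \<psi> (2 * R) * R powr (1/2)"
    using k \<open>0 \<le> R\<close> weight_nonneg[OF \<psi>, of "2 * R"] by simp_all
  have L_eq: "L = k + k * \<psi> (2 * R) + k * \<psi> (2 * R) * R powr (1/2)"
    by (simp add: L_def algebra_simps)
  have holder: "holder_on (1/2) (k * \<psi> (2 * R)) (cball 0 R) D"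
    unfolding holder_on_def
  proof (intro conjI ballI nonneg)
    fix x y :: "real ^ 'n" assume xy: "x \<in> cball 0 R" "y \<in> cball 0 R"
    have "norm (D x - D y) \<le> k * (norm (x - y) powr (1/2) * \<psi> (norm x + norm y))"
      unfolding D_def by (rule bounds)
    also have "\<dots> \<le> k * (norm (x - y) powr (1/2) * \<psi> (2 * R))"
      using xy k by (intro mult_left_mono weight_mono[OF \<psi>]) auto
    finally show "dist (D x) (D y) \<le> k * \<psi> (2 * R) * dist x y powr (1/2)"
      by (simp add: dist_norm mult_ac)
  qed
  have "norm (D x) \<le> L" if x: "x \<in> cball 0 R" for x
  proof -
    have "norm (D x) \<le> norm (D 0) + norm (D x - D 0)" by (rule norm_triangle_sub)
    also have "\<dots> \<le> k + k * \<psi> (2 * R) * norm x powr (1/2)"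
      using bounds(2) holder_onD[OF holder x, of 0] \<open>0 \<le> R\<close>
      by (intro add_mono) (simp_all add: D_def dist_norm)
    also have "\<dots> \<le> k + k * \<psi> (2 * R) * R powr (1/2)"
      using x nonneg by (intro add_left_mono mult_left_mono powr_mono2) auto
    also have "\<dots> \<le> L" using nonneg by (simp add: L_eq)
    finally show ?thesis .
  qed
  moreover have "holder_on (1/2) L (cball 0 R) D"
    using k nonneg by (intro holder_on_mono[OF holder]) (simp add: L_eq)
  ultimately show ?thesis
    unfolding C1_holder_on_def L_def[symmetric] D_def
    using cont_diff_has_derivative[OF bounds(1)] has_derivative_at_withinI by blast
qed

lemma time_Holder_C32_norm_le_imp_increment:
  assumes "time_Holder_C32_norm \<gamma> \<psi> A \<le> ennreal K" "0 \<le> K" and st: "0 \<le> s" "s < t" "t \<le> 1"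
  shows "C32_norm \<psi> (\<lambda>x. A t x - A s x) \<le> ennreal (K * (t - s) powr \<gamma>)"
proof -
  have "C32_norm \<psi> (\<lambda>x. A t x - A s x) / ennreal (\<bar>t - s\<bar> powr \<gamma>) \<le> time_Holder_C32_norm \<gamma> \<psi> A"
    unfolding time_Holder_C32_norm_def by (rule SUP_upper2[of "(s, t)"]) (use st in auto)
  then have "C32_norm \<psi> (\<lambda>x. A t x - A s x) / ennreal ((t - s) powr \<gamma>) \<le> ennreal K"
    using assms(1) st by simp
  then have "C32_norm \<psi> (\<lambda>x. A t x - A s x) \<le> ennreal K * ennreal ((t - s) powr \<gamma>)"
    by (rule ennreal_le_mult_of_divide_le) auto
  then show ?thesis using \<open>0 \<le> K\<close> by (simp add: ennreal_mult)
qed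

lemma time_Holder_C32_norm_finite_imp_C1_holder_on:
  fixes A :: "real \<Rightarrow> real ^ 'n \<Rightarrow> real ^ 'n"
  assumes "time_Holder_C32_norm \<gamma> \<psi> A < \<infinity>" and \<psi>: "weight \<psi>" and "bounded X"
  obtains L where "0 \<le> L"
    "\<And>s t. 0 \<le> s \<Longrightarrow> s < t \<Longrightarrow> t \<le> 1 \<Longrightarrow> C1_holder_on (1/2) (L * (t - s) powr \<gamma>) X (\<lambda>x. A t x - A s x)"
proof -
  obtain K where K: "time_Holder_C32_norm \<gamma> \<psi> A = ennreal K" "0 \<le> K"
    using assms(1) by (cases "time_Holder_C32_norm \<gamma> \<psi> A") auto
  obtain R where R: "0 < R" "X \<subseteq> cball 0 R"
    using bounded_subset_ballD[OF \<open>bounded X\<close>] ball_subset_cball by blast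
  define c where "c = 1 + (1 + R powr (1/2)) * \<psi> (2 * R)"
  have "0 \<le> c" using R(1) weight_nonneg[OF \<psi>, of "2 * R"] by (simp add: c_def)
  show thesis
  proof (rule that)
    show "0 \<le> K * c" using K \<open>0 \<le> c\<close> by simp
    fix s t :: real assume st: "0 \<le> s" "s < t" "t \<le> 1"
    have "C1_holder_on (1/2) (K * (t - s) powr \<gamma> * c) (cball 0 R) (\<lambda>x. A t x - A s x)"
      unfolding c_def using time_Holder_C32_norm_le_imp_increment[of \<gamma> \<psi> A K s t] K st R(1) \<psi>
      by (intro C32_norm_le_imp_C1_holder_on) auto
    then show "C1_holder_on (1/2) (K * c * (t - s) powr \<gamma>) X (\<lambda>x. A t x - A s x)"
      using R(2) by (auto simp: mult_ac intro: C1_holder_on_subset)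
  qed
qed

locale additive_equation =
  fixes w :: "real \<Rightarrow> real ^ 'n" and b :: "real ^ 'n \<Rightarrow> real ^ 'n"
  assumes continuous_path: "continuous_on {0..1} w"
    and bounded_drift: "bounded (range b)" and continuous_drift: "continuous_on UNIV b"
begin

definition drift_bound :: real where
  "drift_bound = (SUP z. norm (b z))"

definition shifted_drift :: "real \<Rightarrow> real ^ 'n \<Rightarrow> real ^ 'n" where
  "shifted_drift r z = b (z + w r)"

lemma continuous_on_shifted_drift:
  "continuous_on ({0..1} \<times> UNIV) (\<lambda>(r, z). shifted_drift r z)"
  unfolding shifted_drift_def case_prod_beta
  by (intro continuous_on_compose2[OF continuous_drift] continuous_on_compose2[OF continuous_path]
      continuous_intros) auto

sublocale bounded_continuous_field shifted_drift 1 drift_bound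
proof
  have "bdd_above (range (\<lambda>z. norm (b z)))"
    using bounded_drift by (auto simp: bounded_iff bdd_above_def)
  then show "norm (shifted_drift r z) \<le> drift_bound" for r z
    unfolding shifted_drift_def drift_bound_def by (rule cSUP_upper[OF UNIV_I])
qed (use continuous_on_shifted_drift in auto)

lemma solves_iff_integral_curve:
  "solves w b x\<^sub>0 x \<longleftrightarrow> integral_curve shifted_drift 1 x\<^sub>0 (\<lambda>t. x t - w t)"
proof -
  have "continuous_on {0..1} x \<longleftrightarrow> continuous_on {0..1} (\<lambda>t. x t - w t)"
    using continuous_on_add[OF _ continuous_path, of "\<lambda>t. x t - w t"]
      continuous_on_diff[OF _ continuous_path, of x] by auto
  then show ?thesis
    by (auto simp: solves_def integral_curve_def shifted_drift_def algebra_simps)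
qed

lemma solution_exists: "\<exists>x. solves w b x\<^sub>0 x"
proof -
  obtain \<theta> where "integral_curve shifted_drift 1 x\<^sub>0 \<theta>" using integral_curve_exists by blast
  then have "solves w b x\<^sub>0 (\<lambda>t. \<theta> t + w t)" by (simp add: solves_iff_integral_curve)
  then show ?thesis by blast
qed

lemma averaging_increment:
  assumes "0 \<le> s" "s \<le> t" "t \<le> 1"
  shows "averaging w b t x - averaging w b s x = averaged shifted_drift s t x"
  using integral_increment[OF integrable_field_along, of 0 t "\<lambda>_. x" s] assms
  by (simp add: averaging_def averaged_def shifted_drift_def)

lemma shifted_solution_in_cball:
  assumes x: "solves w b x\<^sub>0 x" and "x\<^sub>0 \<in> cball z \<rho>"
  shows "(\<lambda>t. x t - w t) ` {0..1} \<subseteq> cball z (\<rho> + drift_bound)"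
proof (rule image_subsetI)
  fix t :: real assume "t \<in> {0..1}"
  then have "x t - w t \<in> cball x\<^sub>0 (drift_bound * 1)"
    using integral_curve_in_cball[OF x[unfolded solves_iff_integral_curve]] by blast
  with \<open>x\<^sub>0 \<in> cball z \<rho>\<close> show "x t - w t \<in> cball z (\<rho> + drift_bound)"
    using dist_triangle[of z "x t - w t" x\<^sub>0] by simp
qed

end

locale regularized_equation = additive_equation +
  fixes \<gamma> :: real and \<psi> :: "real \<Rightarrow> real"
  assumes time_exponent: "1/2 < \<gamma>" and weight: "weight \<psi>"
    and averaging_regularity: "time_Holder_C32_norm \<gamma> \<psi> (averaging w b) < \<infinity>"
begin

lemma regularized_field_on_bounded_convex:
  assumes "bounded X" "convex X"
  shows "\<exists>L. regularized_field shifted_drift 1 drift_bound X L (1/2) \<gamma>"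
proof -
  obtain L where L: "0 \<le> L" "\<And>s t. 0 \<le> s \<Longrightarrow> s < t \<Longrightarrow> t \<le> 1 \<Longrightarrow>
      C1_holder_on (1/2) (L * (t - s) powr \<gamma>) X (\<lambda>x. averaging w b t x - averaging w b s x)"
    using time_Holder_C32_norm_finite_imp_C1_holder_on[OF averaging_regularity weight \<open>bounded X\<close>]
    by metis
  have "regularized_field shifted_drift 1 drift_bound X L (1/2) \<gamma>"
  proof
    fix s t :: real assume "0 \<le> s" "s < t" "t \<le> 1"
    then show "C1_holder_on (1/2) (L * (t - s) powr \<gamma>) X (averaged shifted_drift s t)"
      using L(2)[of s t] by (simp add: averaging_increment)
  qed (use time_exponent \<open>convex X\<close> L in auto)
  then show ?thesis by blast
qed

theorem solves_locally_lipschitz: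
  obtains K where "0 \<le> K"
    "\<And>x\<^sub>0 y\<^sub>0 x y t. \<lbrakk>x\<^sub>0 \<in> cball z \<rho>; y\<^sub>0 \<in> cball z \<rho>;
      solves w b x\<^sub>0 x; solves w b y\<^sub>0 y; t \<in> {0..1}\<rbrakk> \<Longrightarrow> dist (x t) (y t) \<le> K * dist x\<^sub>0 y\<^sub>0"
proof -
  define X where "X = cball z (\<rho> + drift_bound)"
  obtain L where "regularized_field shifted_drift 1 drift_bound X L (1/2) \<gamma>"
    unfolding X_def using regularized_field_on_bounded_convex[OF bounded_cball convex_cball]
    by blast
  then interpret regularized_field shifted_drift 1 drift_bound X L "1/2" \<gamma> .
  show thesis
  proof (rule that)
    fix x\<^sub>0 y\<^sub>0 x y and t :: real
    assume initial: "x\<^sub>0 \<in> cball z \<rho>" "y\<^sub>0 \<in> cball z \<rho>"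
      and xy: "solves w b x\<^sub>0 x" "solves w b y\<^sub>0 y" and "t \<in> {0..1}"
    then have "norm ((x t - w t) - (y t - w t)) \<le> 2 ^ nat \<lceil>1 / doubling_time\<rceil> * norm (x\<^sub>0 - y\<^sub>0)"
      using shifted_solution_in_cball[OF xy(1) initial(1)]
        shifted_solution_in_cball[OF xy(2) initial(2)]
      by (intro integral_curve_stability[OF xy[unfolded solves_iff_integral_curve]])
        (simp_all add: X_def)
    then show "dist (x t) (y t) \<le> 2 ^ nat \<lceil>1 / doubling_time\<rceil> * dist x\<^sub>0 y\<^sub>0"
      by (simp add: dist_norm)
  qed simp
qed

corollary solution_unique:
  assumes "solves w b x\<^sub>0 x" "solves w b x\<^sub>0 y" "t \<in> {0..1}"
  shows "y t = x t"
proof -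
  obtain K where "dist (y t) (x t) \<le> K * dist x\<^sub>0 x\<^sub>0"
    using solves_locally_lipschitz[of x\<^sub>0 0] assms by (metis centre_in_cball order_refl)
  then show ?thesis by simp
qed

corollary flow_locally_lipschitz:
  assumes "\<And>x\<^sub>0. solves w b x\<^sub>0 (\<Phi> x\<^sub>0)"
  shows "\<exists>K. \<forall>t\<in>{0..1}. K-lipschitz_on (cball z \<rho>) (\<lambda>x\<^sub>0. \<Phi> x\<^sub>0 t)"
proof -
  obtain K where "0 \<le> K" "\<And>x\<^sub>0 y\<^sub>0 t. x\<^sub>0 \<in> cball z \<rho> \<Longrightarrow> y\<^sub>0 \<in> cball z \<rho> \<Longrightarrow> t \<in> {0..1} \<Longrightarrow>
      dist (\<Phi> x\<^sub>0 t) (\<Phi> y\<^sub>0 t) \<le> K * dist x\<^sub>0 y\<^sub>0"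
    using solves_locally_lipschitz[of z \<rho>] assms by metis
  then show ?thesis by (auto intro!: exI[of _ K] lipschitz_onI)
qed

end

theorem theorem1p8:
  fixes w :: "real \<Rightarrow> real ^ 'n"
    and b :: "real ^ 'n \<Rightarrow> real ^ 'n"
    and \<gamma> :: real
    and \<psi> :: "real \<Rightarrow> real"
  assumes "continuous_on {0..1} w" and "w 0 = 0"
    and "bounded (range b)" and "continuous_on UNIV b"
    and "\<gamma> > 1/2"
    and "weight \<psi>"
    and "time_Holder_C32_norm \<gamma> \<psi> (averaging w b) < \<infinity>"
  shows "(\<forall>x0. \<exists>x. solves w b x0 x \<and> (\<forall>y. solves w b x0 y \<longrightarrow> (\<forall>t\<in>{0..1}. y t = x t))) \<and>
         (\<forall>\<Phi>. (\<forall>x0. solves w b x0 (\<Phi> x0)) \<longrightarrow>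
           (\<forall>z. \<exists>u>0. \<exists>L. \<forall>t\<in>{0..1}. L-lipschitz_on (cball z u) (\<lambda>x0. \<Phi> x0 t)))"
proof -
  interpret regularized_equation w b \<gamma> \<psi>
    using assms by unfold_locales
  show ?thesis
  proof (intro conjI allI impI)
    show "\<exists>x. solves w b x0 x \<and> (\<forall>y. solves w b x0 y \<longrightarrow> (\<forall>t\<in>{0..1}. y t = x t))" for x0
      using solution_exists solution_unique by blast
    show "\<exists>u>0. \<exists>L. \<forall>t\<in>{0..1}. L-lipschitz_on (cball z u) (\<lambda>x0. \<Phi> x0 t)"
      if "\<forall>x0. solves w b x0 (\<Phi> x0)" for \<Phi> z
      using flow_locally_lipschitz[of \<Phi> z 1] that zero_less_one by blast
  qed
qed

end
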